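(* Let $X$ be a finite set. For any $\ast\in\mathcal{M}(X)$, the principal left ideal generated by $\ast$ is $$\mathcal{M}(X)\ast=\{\diamond\in\mathcal{M}(X) : im(T_\diamond)\subseteq im(T_\ast)\text{ and } diag(T_\diamond)\subseteq diag(T_\ast)\}.$$
   Context: $\mathcal{M}(X)=X^{X\times X}$ is the set of all binary operations on $X$, a monoid under $\triangleright$ defined by $a(\circ\triangleright\ast)b=(a\circ b)\ast(b\circ a)$ for all $a,b\in X$, with identity $a\circ_{lz}b=a$. The principal left ideal generated by $\ast$ is $\mathcal{M}(X)\ast=\{\circ\triangleright\ast : \circ\in\mathcal{M}(X)\}$. The pairmorph transformation induced by $\ast\in\mathcal{M}(X)$ is $T_\ast:X\times X\to X\times X$, $T_\ast(a,b)=(a\ast b,b\ast a)$. With $\Delta(X)=\{(x,x):x\in X\}$, the pairmorph image is $im(T_\ast)=T_\ast(X\times X)$ and the diagonal image is $diag(T_\ast)=T_\ast(\Delta(X))$. *)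

theory Defs
  imports "HOL-Algebra.Group"
begin

text \<open>Operations are extensional functions (fixed to \<^const>\<open>undefined\<close> outside \<open>X \<times> X\<close>), so that
  equality in \<open>binops X\<close> is equality of operations on the set \<open>X\<close>, which may be empty.\<close>

definition binops :: "'a set \<Rightarrow> ('a \<times> 'a \<Rightarrow> 'a) set" where
  "binops X = (X \<times> X) \<rightarrow>\<^sub>E X"

definition op_comp :: "'a set \<Rightarrow> ('a \<times> 'a \<Rightarrow> 'a) \<Rightarrow> ('a \<times> 'a \<Rightarrow> 'a) \<Rightarrow> ('a \<times> 'a \<Rightarrow> 'a)" where
  "op_comp X f g = restrict (\<lambda>(a, b). g (f (a, b), f (b, a))) (X \<times> X)"

definition left_zero_op :: "'a set \<Rightarrow> ('a \<times> 'a \<Rightarrow> 'a)" where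
  "left_zero_op X = restrict (\<lambda>(a, b). a) (X \<times> X)"

definition binop_monoid :: "'a set \<Rightarrow> ('a \<times> 'a \<Rightarrow> 'a) monoid" where
  "binop_monoid X = \<lparr>carrier = binops X, monoid.mult = op_comp X, one = left_zero_op X\<rparr>"

lemma monoid_binop_monoid: "monoid (binop_monoid X)"
  by (rule monoidI)
    (auto simp: binop_monoid_def binops_def op_comp_def left_zero_op_def
        PiE_iff extensional_def fun_eq_iff)

definition principal_left_ideal :: "('a, 'b) monoid_scheme \<Rightarrow> 'a \<Rightarrow> 'a set" where
  "principal_left_ideal M a = {x \<otimes>\<^bsub>M\<^esub> a | x. x \<in> carrier M}"

definition pairmorph :: "('a \<times> 'a \<Rightarrow> 'a) \<Rightarrow> 'a \<times> 'a \<Rightarrow> 'a \<times> 'a" where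
  "pairmorph f = (\<lambda>(a, b). (f (a, b), f (b, a)))"

definition pairmorph_image :: "'a set \<Rightarrow> ('a \<times> 'a \<Rightarrow> 'a) \<Rightarrow> ('a \<times> 'a) set" where
  "pairmorph_image X f = pairmorph f ` (X \<times> X)"

text \<open>\<^term>\<open>Id_on X\<close> is the diagonal of \<open>X \<times> X\<close>.\<close>

definition diagonal_image :: "'a set \<Rightarrow> ('a \<times> 'a \<Rightarrow> 'a) \<Rightarrow> ('a \<times> 'a) set" where
  "diagonal_image X f = pairmorph f ` Id_on X"

end

theory Submission
  imports Defs
begin

text \<open>
  The factorisation of \<open>d\<close> through \<open>star\<close> amounts to lifting \<^term>\<open>pairmorph d\<close> along
  \<^term>\<open>pairmorph star\<close> to a map of the form \<^term>\<open>pairmorph f\<close>, that is, to a map commuting with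
  the swap of coordinates. A lift may be chosen freely on one of \<open>(a, b)\<close>, \<open>(b, a)\<close> and transported
  to the other by the swap; only on the diagonal does equivariance constrain the choice,
  which is what the condition on diagonal images provides for.
\<close>

lemma principal_left_ideal_binop_monoid:
  "principal_left_ideal (binop_monoid X) star = (\<lambda>f. op_comp X f star) ` binops X"
  by (auto simp: principal_left_ideal_def binop_monoid_def)

lemma binops_closed: "f \<in> binops X \<Longrightarrow> a \<in> X \<Longrightarrow> b \<in> X \<Longrightarrow> f (a, b) \<in> X"
  by (auto simp: binops_def)

lemma op_comp_in_binops:
  "f \<in> binops X \<Longrightarrow> g \<in> binops X \<Longrightarrow> op_comp X f g \<in> binops X"
  by (auto simp: op_comp_def binops_def)

text \<open>Swapping the arguments swaps the coordinates of \<open>pairmorph f (a, b)\<close>, so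
  \<open>op_comp\<close> becomes composition of self-maps of the square, with \<open>f\<close>
  acting first.\<close>

lemma pairmorph_op_comp:
  "a \<in> X \<Longrightarrow> b \<in> X \<Longrightarrow> pairmorph (op_comp X f g) (a, b) = pairmorph g (pairmorph f (a, b))"
  by (simp add: pairmorph_def op_comp_def)

lemma pairmorph_image_op_comp_subset:
  assumes "f \<in> binops X"
  shows "pairmorph_image X (op_comp X f g) \<subseteq> pairmorph_image X g"
proof -
  have "pairmorph f p \<in> X \<times> X" if "p \<in> X \<times> X" for p
    using that binops_closed[OF assms] by (auto simp: pairmorph_def)
  then show ?thesis
    by (auto simp: pairmorph_image_def pairmorph_op_comp)
qed

text \<open>Equal arguments give equal coordinates, so \<open>pairmorph f\<close> maps the diagonal
  of \<open>X\<close> into itself.\<close>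

lemma diagonal_image_op_comp_subset:
  assumes "f \<in> binops X"
  shows "diagonal_image X (op_comp X f g) \<subseteq> diagonal_image X g"
proof -
  have "pairmorph f p \<in> Id_on X" if "p \<in> Id_on X" for p
    using that binops_closed[OF assms] by (auto simp: pairmorph_def)
  moreover have "pairmorph (op_comp X f g) p = pairmorph g (pairmorph f p)" if "p \<in> Id_on X" for p
    using that by (auto simp: pairmorph_op_comp)
  ultimately show ?thesis
    unfolding diagonal_image_def by (metis image_subsetI imageI)
qed

lemma exists_op_comp_factor:
  assumes "finite X" and d: "d \<in> binops X"
    and im: "pairmorph_image X d \<subseteq> pairmorph_image X g"
    and diag: "diagonal_image X d \<subseteq> diagonal_image X g"
  shows "\<exists>f \<in> binops X. d = op_comp X f g"
proof -
  have lift: "\<exists>q. q \<in> X \<times> X \<and> pairmorph g q = pairmorph d p \<and> (fst p = snd p \<longrightarrow> fst q = snd q)"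
    if p: "p \<in> X \<times> X" for p
  proof (cases "fst p = snd p")
    case True
    then have "pairmorph d p \<in> diagonal_image X g"
      using p diag by (force simp: diagonal_image_def)
    then obtain x where "x \<in> X" "pairmorph g (x, x) = pairmorph d p"
      by (auto simp: diagonal_image_def)
    then show ?thesis
      by (intro exI[of _ "(x, x)"]) simp
  next
    case False
    have "pairmorph d p \<in> pairmorph_image X g"
      using p im unfolding pairmorph_image_def by blast
    then obtain q where "q \<in> X \<times> X" "pairmorph g q = pairmorph d p"
      unfolding pairmorph_image_def by (metis imageE)
    then show ?thesis
      using False by blast
  qed
  have "\<exists>l. \<forall>p \<in> X \<times> X. l p \<in> X \<times> X \<and>
      pairmorph g (l p) = pairmorph d p \<and> (fst p = snd p \<longrightarrow> fst (l p) = snd (l p))"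
    using lift by (intro bchoice) blast
  then obtain l where "\<forall>p \<in> X \<times> X. l p \<in> X \<times> X \<and>
      pairmorph g (l p) = pairmorph d p \<and> (fst p = snd p \<longrightarrow> fst (l p) = snd (l p))" ..
  then have l: "l p \<in> X \<times> X" "pairmorph g (l p) = pairmorph d p"
      "fst p = snd p \<Longrightarrow> fst (l p) = snd (l p)" if "p \<in> X \<times> X" for p
    using that by (simp_all only: Ball_def)
  \<comment> \<open>Finiteness supplies an injection into the naturals; comparing its values selects
    one of \<open>(a, b)\<close> and \<open>(b, a)\<close> whenever \<open>a\<close> and
    \<open>b\<close> differ.\<close>
  obtain i :: "'a \<Rightarrow> nat" where i: "inj_on i X"
    using finite_imp_inj_to_nat_seg[OF \<open>finite X\<close>] by blast
  \<comment> \<open>For \<open>a\<close> and \<open>b\<close> distinct,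
    \<open>pairmorph f (a, b)\<close> is \<open>l (a, b)\<close> if \<open>i a < i b\<close>, and
    the swap of \<open>l (b, a)\<close> otherwise.\<close>
  define f where
    "f = restrict (\<lambda>(a, b). if i a \<le> i b then fst (l (a, b)) else snd (l (b, a))) (X \<times> X)"
  have "fst (l (a, b)) \<in> X" "snd (l (a, b)) \<in> X" if "a \<in> X" "b \<in> X" for a b
    using l(1)[of "(a, b)"] that by (auto simp: mem_Times_iff)
  then have "f \<in> binops X"
    by (auto simp: f_def binops_def)
  moreover have "d = op_comp X f g"
  proof
    fix p
    show "d p = op_comp X f g p"
    proof (cases "p \<in> X \<times> X")
      case False
      \<comment> \<open>Off the square both operations take the value
        \<open>undefined\<close>.\<close>
      then show ?thesis
        using PiE_arb[OF d[unfolded binops_def]] by (simp add: op_comp_def restrict_def)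
    next
      case True
      then obtain a b where p: "p = (a, b)" "a \<in> X" "b \<in> X"
        by blast
      \<comment> \<open>The two coordinates of the lifting equation: the second one gives
        \<open>d\<close> at the swapped pair.\<close>
      have comp: "g (fst (l (x, y)), snd (l (x, y))) = d (x, y)"
        "g (snd (l (x, y)), fst (l (x, y))) = d (y, x)" if "x \<in> X" "y \<in> X" for x y
        using l(2)[of "(x, y)"] that by (simp_all add: pairmorph_def case_prod_unfold)
      consider "a = b" | "i a < i b" | "i b < i a"
        using inj_onD[OF i _ p(2,3)] linorder_neqE_nat by blast
      then have "g (f (a, b), f (b, a)) = d (a, b)"
      proof cases
        case 1
        \<comment> \<open>Here both arguments of \<open>g\<close> are \<open>fst (l (a, a))\<close>,
          so \<open>l (a, a)\<close> has to lie on the diagonal. The rule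
          \<open>prod.collapse\<close> would fold the pair in \<open>comp\<close> back into
          \<open>l (a, a)\<close> and hide the coordinates to be identified.\<close>
        then show ?thesis
          using p comp(1)[of a a] l(3)[of "(a, a)"] by (simp add: f_def del: prod.collapse)
      next
        case 2
        then show ?thesis
          using p comp(1)[of a b] by (simp add: f_def)
      next
        case 3
        then show ?thesis
          using p comp(2)[of b a] by (simp add: f_def)
      qed
      then show ?thesis
        using p by (simp add: op_comp_def)
    qed
  qed
  ultimately show ?thesis
    by blast
qed

theorem theorem4:
  fixes X :: "'a set" and star :: "'a \<times> 'a \<Rightarrow> 'a"
  assumes "finite X" and "star \<in> binops X"
  shows "principal_left_ideal (binop_monoid X) star =
    {d \<in> binops X. pairmorph_image X d \<subseteq> pairmorph_image X star \<and>
      diagonal_image X d \<subseteq> diagonal_image X star}"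
  unfolding principal_left_ideal_binop_monoid
proof (intro equalityI subsetI)
  fix d
  assume "d \<in> (\<lambda>f. op_comp X f star) ` binops X"
  then obtain f where f: "f \<in> binops X" and d: "d = op_comp X f star"
    by blast
  show "d \<in> {d \<in> binops X. pairmorph_image X d \<subseteq> pairmorph_image X star \<and>
      diagonal_image X d \<subseteq> diagonal_image X star}"
    unfolding d
    by (intro CollectI conjI op_comp_in_binops[OF f assms(2)]
        pairmorph_image_op_comp_subset[OF f] diagonal_image_op_comp_subset[OF f])
next
  fix d
  assume "d \<in> {d \<in> binops X. pairmorph_image X d \<subseteq> pairmorph_image X star \<and>
      diagonal_image X d \<subseteq> diagonal_image X star}"
  then have "\<exists>f \<in> binops X. d = op_comp X f star"
    by (intro exists_op_comp_factor[OF assms(1)]) simp_all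
  then show "d \<in> (\<lambda>f. op_comp X f star) ` binops X"
    by blast
qed

end
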